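(* Let $\omega:(0,\infty) \times (0,\infty) \to (0,\infty)$ and $T: \mathbb{R} \to \mathbb{R}$ be such that $T$ is strongly nonexpansive with modulus $\omega$. Then $T$ is super strongly nonexpansive with modulus $$\chi(\varepsilon):=\min\left((\omega(1,\varepsilon))^2,\varepsilon^2,(\omega(1,1/2))^2,1\right).$$
   Context: Let $X$ be a Banach space (here $X=\mathbb{R}$ with the absolute value), $S\subseteq X$ and $T:S\to X$. $T$ is strongly nonexpansive with modulus $\omega:(0,\infty)\times(0,\infty)\to(0,\infty)$ if $\omega$ is an SNE-modulus for $T$: for any $b,\varepsilon>0$ and $x,y\in S$ with $\|x-y\|\le b$ and $\|x-y\|-\|Tx-Ty\|<\omega(b,\varepsilon)$, we have $\|(x-y)-(Tx-Ty)\|<\varepsilon$. (Existence of such an $\omega$ is equivalent to strong nonexpansiveness: $T$ is nonexpansive, i.e. $\|Tx-Ty\|\le\|x-y\|$ for all $x,y\in S$, and whenever $(x_n),(y_n)\subseteq S$ with $(x_n-y_n)$ bounded and $\|x_n-y_n\|-\|Tx_n-Ty_n\|\to0$, then $(x_n-y_n)-(Tx_n-Ty_n)\to0$.) $T$ is super strongly nonexpansive with modulus $\chi:(0,\infty)\to(0,\infty)$ if $\chi$ is an SSNE-modulus for $T$: for any $\varepsilon>0$ and $x,y\in S$ with $\|x-y\|^2-\|Tx-Ty\|^2<\chi(\varepsilon)$, we have $\|(x-y)-(Tx-Ty)\|<\varepsilon$. (Existence of such a $\chi$ is equivalent to super strong nonexpansiveness.) *)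

theory Defs
  imports Complex_Main
begin

text \<open>A map \<open>T : S \<rightarrow> X\<close> is a total function of which only the values on \<open>S\<close> matter; likewise
  a modulus is a total function on the reals of which only the values at positive arguments
  matter, and these are required to be positive.\<close>

definition sne_with_modulus ::
    "'a::banach set \<Rightarrow> ('a \<Rightarrow> 'a) \<Rightarrow> (real \<Rightarrow> real \<Rightarrow> real) \<Rightarrow> bool" where
  "sne_with_modulus S T \<omega> \<longleftrightarrow>
     (\<forall>b>0. \<forall>\<epsilon>>0. \<omega> b \<epsilon> > 0) \<and>
     (\<forall>b>0. \<forall>\<epsilon>>0. \<forall>x\<in>S. \<forall>y\<in>S.
        norm (x - y) \<le> b \<longrightarrow> norm (x - y) - norm (T x - T y) < \<omega> b \<epsilon> \<longrightarrow>
        norm ((x - y) - (T x - T y)) < \<epsilon>)"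

definition ssne_with_modulus ::
    "'a::banach set \<Rightarrow> ('a \<Rightarrow> 'a) \<Rightarrow> (real \<Rightarrow> real) \<Rightarrow> bool" where
  "ssne_with_modulus S T \<chi> \<longleftrightarrow>
     (\<forall>\<epsilon>>0. \<chi> \<epsilon> > 0) \<and>
     (\<forall>\<epsilon>>0. \<forall>x\<in>S. \<forall>y\<in>S.
        (norm (x - y))\<^sup>2 - (norm (T x - T y))\<^sup>2 < \<chi> \<epsilon> \<longrightarrow>
        norm ((x - y) - (T x - T y)) < \<epsilon>)"

end

theory Submission
  imports Defs
begin

text \<open>Since \<open>(d - \<bar>t\<bar>)\<^sup>2 \<le> d\<^sup>2 - t\<^sup>2\<close> for \<open>\<bar>t\<bar> \<le> d\<close>, the claim is immediate for points at distance
  at most 1, and also whenever \<open>T\<close> preserves the order of \<open>y < x\<close>. If \<open>x - y > 1\<close> and \<open>T\<close> reversed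
  the order, then the pair \<open>y, y + 1\<close> would lose no more length under \<open>T\<close> than \<open>y, x\<close> does, so
  \<open>T (y + 1) - T y > 1/2\<close>; this step in the wrong direction costs the pair \<open>y, x\<close> more than
  the bound 1 on \<open>d\<^sup>2 - t\<^sup>2\<close> allows.\<close>

lemma sne_with_modulusD:
  assumes "sne_with_modulus S T \<omega>" "b > 0" "\<epsilon> > 0" "x \<in> S" "y \<in> S"
    and "norm (x - y) \<le> b" "norm (x - y) - norm (T x - T y) < \<omega> b \<epsilon>"
  shows "norm ((x - y) - (T x - T y)) < \<epsilon>"
  using assms unfolding sne_with_modulus_def by blast

lemma sne_with_modulus_pos:
  assumes "sne_with_modulus S T \<omega>" "b > 0" "\<epsilon> > 0"
  shows "\<omega> b \<epsilon> > 0"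
  using assms unfolding sne_with_modulus_def by blast

text \<open>If \<open>T\<close> expanded a pair, its loss of length would be negative, hence below
  \<open>\<omega> b \<epsilon>\<close> for every \<open>\<epsilon> > 0\<close>. This forces
  \<open>x - y = T x - T y\<close>, so the norms agree after all.\<close>

lemma sne_with_modulus_nonexpansive:
  assumes sne: "sne_with_modulus S T \<omega>" and xy: "x \<in> S" "y \<in> S"
  shows "norm (T x - T y) \<le> norm (x - y)"
proof (rule ccontr)
  assume exp: "\<not> norm (T x - T y) \<le> norm (x - y)"
  \<comment> \<open>The summand 1 keeps \<open>b\<close> positive when \<open>x = y\<close>.\<close>
  define b where "b = norm (x - y) + 1"
  have b: "b > 0" "norm (x - y) \<le> b"
    by (simp_all add: b_def add_nonneg_pos)
  have "norm ((x - y) - (T x - T y)) < \<epsilon>" if "\<epsilon> > 0" for \<epsilon>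
    using sne_with_modulus_pos[OF sne b(1) that] exp
    by (intro sne_with_modulusD[OF sne b(1) that xy b(2)]) linarith
  from this[of "norm ((x - y) - (T x - T y))"] have "x - y = T x - T y"
    by auto
  with exp show False
    by simp
qed

lemma diff_less_of_power2_diff_less:
  fixes s d c :: real
  assumes "0 \<le> s" "s \<le> d" "0 < c" "d\<^sup>2 - s\<^sup>2 < c\<^sup>2"
  shows "d - s < c"
proof -
  have "(d - s)\<^sup>2 \<le> (d - s) * (d + s)"
    unfolding power2_eq_square using assms(1,2) by (intro mult_left_mono) auto
  also have "\<dots> = d\<^sup>2 - s\<^sup>2"
    by (simp add: power2_eq_square algebra_simps)
  finally have "(d - s)\<^sup>2 < c\<^sup>2"
    using assms(4) by linarith
  then show ?thesis
    using assms(3) by (simp add: power2_less_imp_less)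
qed

lemma sne_with_modulus_real_order_preserving:
  fixes T :: "real \<Rightarrow> real"
  assumes sne: "sne_with_modulus UNIV T \<omega>" and far: "x - y > 1"
    and small: "(x - y)\<^sup>2 - (T x - T y)\<^sup>2 < (\<omega> 1 (1/2))\<^sup>2" "(x - y)\<^sup>2 - (T x - T y)\<^sup>2 < 1"
  shows "T y \<le> T x"
proof (rule ccontr)
  assume rev: "\<not> T y \<le> T x"
  have ne: "\<bar>T u - T v\<bar> \<le> \<bar>u - v\<bar>" for u v
    using sne_with_modulus_nonexpansive[OF sne] by simp
  have \<omega>: "\<omega> 1 (1/2) > 0"
    by (rule sne_with_modulus_pos[OF sne]) auto
  have loss: "(x - y) - \<bar>T x - T y\<bar> < \<omega> 1 (1/2)"
    by (rule diff_less_of_power2_diff_less) (use ne[of x y] far small \<omega> in auto)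
  \<comment> \<open>\<open>\<bar>T x - T y\<bar>\<close> is at most
    \<open>(x - y - 1) + \<bar>T (y + 1) - T y\<bar>\<close>, so the unit step loses at most what
    the pair \<open>x, y\<close> loses, which is below \<open>\<omega> 1 (1/2)\<close>.\<close>
  have "\<bar>(y + 1 - y) - (T (y + 1) - T y)\<bar> < 1/2"
    using sne_with_modulusD[OF sne, of 1 "1/2" "y + 1" y] loss ne[of x "y + 1"] far
    by simp
  \<comment> \<open>Now \<open>T x < T y < T (y + 1)\<close>, so
    \<open>\<bar>T x - T y\<bar>\<close> is less than \<open>\<bar>T x - T (y + 1)\<bar>\<close>,
    and nonexpansiveness bounds the latter.\<close>
  then have "\<bar>T x - T y\<bar> \<le> (x - y) - 1"
    using ne[of x "y + 1"] rev far by (simp add: abs_if split: if_splits)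
  then have "(T x - T y)\<^sup>2 \<le> ((x - y) - 1)\<^sup>2"
    using power_mono[of "\<bar>T x - T y\<bar>" _ 2] by simp
  also have "\<dots> = (x - y)\<^sup>2 - 2 * (x - y) + 1"
    by (simp add: power2_eq_square algebra_simps)
  finally have "2 * (x - y) - 1 \<le> (x - y)\<^sup>2 - (T x - T y)\<^sup>2"
    by simp
  with small(2) have "2 * (x - y) - 1 < 1"
    by (rule le_less_trans[rotated])
  with far show False
    by simp
qed

lemma sne_with_modulus_real_bound:
  fixes T :: "real \<Rightarrow> real"
  assumes sne: "sne_with_modulus UNIV T \<omega>" and \<epsilon>: "\<epsilon> > 0" and le: "y \<le> x"
    and small: "(x - y)\<^sup>2 - (T x - T y)\<^sup>2 < (\<omega> 1 \<epsilon>)\<^sup>2" "(x - y)\<^sup>2 - (T x - T y)\<^sup>2 < \<epsilon>\<^sup>2"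
      "(x - y)\<^sup>2 - (T x - T y)\<^sup>2 < (\<omega> 1 (1/2))\<^sup>2" "(x - y)\<^sup>2 - (T x - T y)\<^sup>2 < 1"
  shows "\<bar>(x - y) - (T x - T y)\<bar> < \<epsilon>"
proof -
  have ne: "\<bar>T x - T y\<bar> \<le> x - y"
    using sne_with_modulus_nonexpansive[OF sne, of x y] le by simp
  have loss: "(x - y) - \<bar>T x - T y\<bar> < c" if "c > 0" "(x - y)\<^sup>2 - (T x - T y)\<^sup>2 < c\<^sup>2" for c
    by (rule diff_less_of_power2_diff_less) (use ne that in auto)
  show ?thesis
  proof (cases "x - y \<le> 1")
    case True
    then show ?thesis
      using sne_with_modulusD[OF sne, of 1 \<epsilon> x y] \<epsilon> le
        loss[OF sne_with_modulus_pos[OF sne] small(1)] by simp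
  next
    case False
    then have "T y \<le> T x"
      by (intro sne_with_modulus_real_order_preserving[OF sne _ small(3,4)]) simp
    \<comment> \<open>With the order preserved, \<open>\<bar>T x - T y\<bar> = T x - T y\<close>, so
      the loss of length is exactly the quantity to be bounded.\<close>
    then show ?thesis
      using loss[OF \<epsilon> small(2)] ne by simp
  qed
qed

theorem proposition2p8:
  fixes \<omega> :: "real \<Rightarrow> real \<Rightarrow> real" and T :: "real \<Rightarrow> real"
  assumes "sne_with_modulus UNIV T \<omega>"
  shows "ssne_with_modulus UNIV T
           (\<lambda>\<epsilon>. Min {(\<omega> 1 \<epsilon>)\<^sup>2, \<epsilon>\<^sup>2, (\<omega> 1 (1/2))\<^sup>2, 1})"
  unfolding ssne_with_modulus_def
proof (intro conjI allI impI ballI)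
  fix \<epsilon> :: real
  assume \<epsilon>: "\<epsilon> > 0"
  show "0 < Min {(\<omega> 1 \<epsilon>)\<^sup>2, \<epsilon>\<^sup>2, (\<omega> 1 (1/2))\<^sup>2, 1}"
    using \<epsilon> sne_with_modulus_pos[OF assms, of 1 \<epsilon>] sne_with_modulus_pos[OF assms, of 1 "1/2"]
    by simp
  fix x y :: real
  assume "(norm (x - y))\<^sup>2 - (norm (T x - T y))\<^sup>2 < Min {(\<omega> 1 \<epsilon>)\<^sup>2, \<epsilon>\<^sup>2, (\<omega> 1 (1/2))\<^sup>2, 1}"
  then have small: "(x - y)\<^sup>2 - (T x - T y)\<^sup>2 < (\<omega> 1 \<epsilon>)\<^sup>2" "(x - y)\<^sup>2 - (T x - T y)\<^sup>2 < \<epsilon>\<^sup>2"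
      "(x - y)\<^sup>2 - (T x - T y)\<^sup>2 < (\<omega> 1 (1/2))\<^sup>2" "(x - y)\<^sup>2 - (T x - T y)\<^sup>2 < 1"
    by simp_all
  show "norm ((x - y) - (T x - T y)) < \<epsilon>"
  proof (cases "y \<le> x")
    case True
    then show ?thesis
      using sne_with_modulus_real_bound[OF assms \<epsilon> _ small] by simp
  next
    case False
    \<comment> \<open>Hypotheses and goal are symmetric in \<open>x\<close> and \<open>y\<close>, so
      the ordered case applies with the two swapped.\<close>
    then have "\<bar>(y - x) - (T y - T x)\<bar> < \<epsilon>"
      using small[unfolded power2_commute[of x y] power2_commute[of "T x" "T y"]]
      by (intro sne_with_modulus_real_bound[OF assms \<epsilon>]) simp_all
    then show ?thesis
      by simp
  qed
qed

end
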